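(* Assume $g$ is concave on $I=[-1,1]$. For $n\ge 2$, the $2^{n-1}\times 2^{n-1}$ matrix $A_n$ whose entries are $$(A_n)_{i,j}=\begin{cases}-\alpha, & j=2^{n-2}+1-\lceil i/2\rceil,\\ \alpha\beta_{ni}, & j=2^{n-2}+\lceil i/2\rceil,\\ 0,&\text{otherwise,}\end{cases}\qquad 1\le i,j\le 2^{n-1},$$ has an eigenvalue $\lambda_n$ which is greater than $\alpha(\alpha-1)$.
   Context: Let $I=[-1,1]$ and let $g:I\to I$ be the (Feigenbaum) fixed point of the period doubling operator: $g$ is an even analytic folding mapping with unique non-degenerate critical point $0$, with $g(0)=1$, $g^{\circ 3}(0)>-g^{\circ 2}(0)>g^{\circ 4}(0)>0>g^{\circ 2}(0)$, and $g(x)=-\alpha\, g\circ g(-\alpha^{-1}x)$ where $\alpha=-1/g(1)$. Put $J=g(I)=[g(1),1]$, $J_0=[g(1),g^{\circ 3}(1)]$, $J_1=[g^{\circ 2}(1),1]$. Define $\sigma:J_0\cup J_1\to J$ by $\sigma(x)=-\alpha x$ on $J_0$ and $\sigma(x)=-\alpha g(x)$ on $J_1$; it is expanding and maps each of $J_0,J_1$ bijectively onto $J$. For $n\ge1$, $\sigma^{-n}(J)$ is a union of $2^n$ disjoint closed intervals $J_{n1},\dots,J_{n2^n}$ labelled from left to right; write $J_{n(2^{n-1}+i)}=[a_{ni},b_{ni}]$ and $\beta_{ni}=|g'(b_{ni})|$ for $i=1,\dots,2^{n-1}$. *)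

theory Defs
  imports "HOL-Analysis.Analysis" "Jordan_Normal_Form.Char_Poly"
begin

text \<open>
  A self-map of \<open>I = [-1,1]\<close> is a function \<open>g :: real \<Rightarrow> real\<close> of which only the values on \<open>I\<close>
  matter. Hence derivatives are taken within \<open>I\<close> (one-sided at the end points), and analyticity is
  given by power series that are only required to represent \<open>g\<close> at points of \<open>I\<close>.
\<close>

definition unit_int :: "real set" where
  "unit_int = {-1..1}"

definition deriv_I :: "(real \<Rightarrow> real) \<Rightarrow> real \<Rightarrow> real" where
  "deriv_I g x = vector_derivative g (at x within unit_int)"

definition real_analytic_on :: "(real \<Rightarrow> real) \<Rightarrow> real set \<Rightarrow> bool" where
  "real_analytic_on f S \<longleftrightarrow>
     (\<forall>x\<in>S. \<exists>r>0. \<exists>c. \<forall>y\<in>S. \<bar>y - x\<bar> < r \<longrightarrow> (\<lambda>k. c k * (y - x) ^ k) sums f y)"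

definition folding_map :: "(real \<Rightarrow> real) \<Rightarrow> bool" where
  "folding_map g \<longleftrightarrow>
     g \<in> unit_int \<rightarrow> unit_int \<and>
     strict_mono_on {-1..0} g \<and> strict_antimono_on {0..1} g"

definition unique_nondegenerate_critical_point :: "(real \<Rightarrow> real) \<Rightarrow> real \<Rightarrow> bool" where
  "unique_nondegenerate_critical_point g c \<longleftrightarrow>
     c \<in> unit_int \<and> (\<forall>x\<in>unit_int. deriv_I g x = 0 \<longleftrightarrow> x = c) \<and>
     deriv_I (deriv_I g) c \<noteq> 0"

definition alpha :: "(real \<Rightarrow> real) \<Rightarrow> real" where
  "alpha g = - 1 / g 1"

definition feigenbaum_map :: "(real \<Rightarrow> real) \<Rightarrow> bool" where
  "feigenbaum_map g \<longleftrightarrow>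
     folding_map g \<and>
     (\<forall>x\<in>unit_int. g (- x) = g x) \<and>
     real_analytic_on g unit_int \<and>
     unique_nondegenerate_critical_point g 0 \<and>
     g 0 = 1 \<and>
     (g ^^ 3) 0 > - (g ^^ 2) 0 \<and> - (g ^^ 2) 0 > (g ^^ 4) 0 \<and>
     (g ^^ 4) 0 > 0 \<and> 0 > (g ^^ 2) 0 \<and>
     (\<forall>x\<in>unit_int. g x = - alpha g * g (g (- x / alpha g)))"

definition J :: "(real \<Rightarrow> real) \<Rightarrow> real set" where
  "J g = {g 1..1}"

definition J0 :: "(real \<Rightarrow> real) \<Rightarrow> real set" where
  "J0 g = {g 1..(g ^^ 3) 1}"

definition J1 :: "(real \<Rightarrow> real) \<Rightarrow> real set" where
  "J1 g = {(g ^^ 2) 1..1}"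

text \<open>\<open>sigma g\<close> is a partial map with domain \<open>J0 g \<union> J1 g\<close>; the domain is enforced in \<open>sigma_preimage\<close>.\<close>

definition sigma :: "(real \<Rightarrow> real) \<Rightarrow> real \<Rightarrow> real" where
  "sigma g x = (if x \<in> J0 g then - alpha g * x else - alpha g * g x)"

definition sigma_preimage :: "(real \<Rightarrow> real) \<Rightarrow> real set \<Rightarrow> real set" where
  "sigma_preimage g S = {x \<in> J0 g \<union> J1 g. sigma g x \<in> S}"

text \<open>
  The disjoint closed intervals constituting \<open>\<sigma>\<^sup>-\<^sup>n(J)\<close> are its connected components. They are listed
  by increasing left end point; \<open>k\<close> counts from 1.
\<close>

definition J_interval :: "(real \<Rightarrow> real) \<Rightarrow> nat \<Rightarrow> nat \<Rightarrow> real set" where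
  "J_interval g n k =
     sorted_key_list_of_set Inf (components ((sigma_preimage g ^^ n) (J g))) ! (k - 1)"

definition b_right :: "(real \<Rightarrow> real) \<Rightarrow> nat \<Rightarrow> nat \<Rightarrow> real" where
  "b_right g n i = Sup (J_interval g n (2 ^ (n - 1) + i))"

definition beta :: "(real \<Rightarrow> real) \<Rightarrow> nat \<Rightarrow> nat \<Rightarrow> real" where
  "beta g n i = \<bar>deriv_I g (b_right g n i)\<bar>"

text \<open>The matrix type indexes rows and columns from 0, the entries below from 1.\<close>

definition A_entry :: "(real \<Rightarrow> real) \<Rightarrow> nat \<Rightarrow> nat \<Rightarrow> nat \<Rightarrow> real" where
  "A_entry g n i j =
     (if j = 2 ^ (n - 2) + 1 - nat \<lceil>real i / 2\<rceil> then - alpha g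
      else if j = 2 ^ (n - 2) + nat \<lceil>real i / 2\<rceil> then alpha g * beta g n i
      else 0)"

definition A_matrix :: "(real \<Rightarrow> real) \<Rightarrow> nat \<Rightarrow> real Matrix.mat" where
  "A_matrix g n =
     Matrix.mat (2 ^ (n - 1)) (2 ^ (n - 1)) (\<lambda>(i, j). A_entry g n (i + 1) (j + 1))"

end

theory Submission
  imports Defs "HOL-Complex_Analysis.Cauchy_Integral_Formula"
begin

text \<open>
  Concavity makes \<open>\<beta>\<^sub>1 \<le> \<beta>\<^sub>2 \<le> \<dots>\<close>, and the functional equation gives \<open>\<beta>\<^sub>1 \<ge> 1\<close> and \<open>g'(1) = -\<alpha>\<close>, so that the
  last one equals \<open>\<alpha>\<close>. Therefore \<open>A\<^sub>n\<close> preserves the cone of nonnegative nondecreasing vectors. On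
  this cone the functional \<open>\<ell>(v) = (\<alpha> + 1) v\<^sub>N - v\<^sub>1\<close>, where \<open>N\<close> is the dimension, satisfies
  \<open>\<ell>(A\<^sub>n v) \<ge> (\<alpha>\<^sup>2 - \<beta>\<^sub>1) \<ell>(v)\<close>. In the coordinates \<open>v\<^sub>i - v\<^sub>i\<^sub>-\<^sub>1\<close> the matrix is nonnegative, and
  a Perron-Frobenius argument yields a real eigenvalue \<open>\<ge> \<alpha>\<^sup>2 - \<beta>\<^sub>1\<close>. This exceeds \<open>\<alpha>\<^sup>2 - \<alpha>\<close>: if
  \<open>\<beta>\<^sub>1 = \<alpha>\<close>, then \<open>g'\<close> would be constant on an interval ending at \<open>1\<close>, hence everywhere by analyticity,
  but \<open>g'(0) = 0\<close>.
\<close>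

section \<open>Nonnegative matrices and the cone of nondecreasing vectors\<close>

text \<open>Take the largest \<open>s\<close> with \<open>s * y \<le> x\<close>: if
  \<open>s < 0\<close>, the strict slack of \<open>y\<close> contradicts the inequality for
  \<open>x\<close> at an index \<open>m\<close> of equality.\<close>

lemma M_matrix_monotone:
  fixes b :: "nat \<Rightarrow> nat \<Rightarrow> real"
  assumes b: "\<And>i j. i < N \<Longrightarrow> j < N \<Longrightarrow> 0 \<le> b i j"
    and y: "\<And>i. i < N \<Longrightarrow> 0 < y i" "\<And>i. i < N \<Longrightarrow> (\<Sum>j<N. b i j * y j) + 1 \<le> t * y i"
    and x: "\<And>i. i < N \<Longrightarrow> (\<Sum>j<N. b i j * x j) \<le> t * x i"
    and i: "i < N"
  shows "0 \<le> x i"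
proof (rule ccontr)
  assume neg: "\<not> 0 \<le> x i"
  define s where "s = Min ((\<lambda>k. x k / y k) ` {..<N})"
  have "s \<in> (\<lambda>k. x k / y k) ` {..<N}"
    unfolding s_def using i by (intro Min_in) auto
  then obtain m where m: "m < N" "s = x m / y m" by auto
  have le: "s \<le> x k / y k" if "k < N" for k
    unfolding s_def using that by (intro Min_le) auto
  have "s < 0"
    using le[OF i] neg y(1)[OF i] by (smt (verit) divide_neg_pos)
  have sy: "s * y k \<le> x k" if "k < N" for k
    using le[OF that] y(1)[OF that] by (simp add: field_simps)
  have "s * (t * y m) < s * (\<Sum>j<N. b m j * y j)"
    using y(2)[OF m(1)] \<open>s < 0\<close> by (intro mult_strict_left_mono_neg) auto
  also have "\<dots> = (\<Sum>j<N. b m j * (s * y j))"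
    by (simp add: sum_distrib_left mult_ac)
  also have "\<dots> \<le> (\<Sum>j<N. b m j * x j)"
    using sy b m by (intro sum_mono mult_left_mono) auto
  also have "\<dots> \<le> t * x m" using x m by auto
  also have "\<dots> = s * (t * y m)" using m y(1)[OF m(1)] by simp
  finally show False by simp
qed

lemma solvable_if_not_eigenvalue:
  fixes B :: "real mat"
  assumes B: "B \<in> carrier_mat N N" and t: "\<not> eigenvalue B t"
  obtains x where "\<And>i. i < N \<Longrightarrow> t * x i - (\<Sum>j<N. B $$ (i, j) * x j) = (1::real)"
proof -
  let ?C = "char_matrix B t"
  have C: "?C \<in> carrier_mat N N" using B by simp
  have "det ?C \<noteq> 0" using t eigenvalue_det[OF B] by simp
  from det_non_zero_imp_unit[OF C this, of undefined]
  obtain D where D: "D \<in> carrier_mat N N" "?C * D = 1\<^sub>m N"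
    by (auto simp: Units_def ring_mat_def)
  \<comment> \<open>\<open>char_matrix B t\<close> is \<open>B - t I\<close>, so the right-hand side
    1 becomes -1.\<close>
  define w where "w = D *\<^sub>v Matrix.vec N (\<lambda>_. -1 :: real)"
  have w: "w \<in> carrier_vec N" unfolding w_def using D by auto
  have "?C *\<^sub>v w = (?C * D) *\<^sub>v Matrix.vec N (\<lambda>_. -1)"
    unfolding w_def using C D by (subst assoc_mult_mat_vec) auto
  then have Cw: "?C *\<^sub>v w = Matrix.vec N (\<lambda>_. -1)" using D by simp
  have "t * w $ i - (\<Sum>j<N. B $$ (i, j) * w $ j) = 1" if i: "i < N" for i
  proof -
    have "-1 = (?C *\<^sub>v w) $ i" using Cw i by simp
    also have "\<dots> = (\<Sum>j<N. ?C $$ (i, j) * w $ j)"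
      using i C w by (simp add: scalar_prod_def atLeast0LessThan)
    also have "\<dots> = (\<Sum>j<N. B $$ (i, j) * w $ j + (if i = j then - t * w $ j else 0))"
      using i B by (intro sum.cong) (auto simp: char_matrix_def algebra_simps)
    also have "\<dots> = (\<Sum>j<N. B $$ (i, j) * w $ j) - t * w $ i"
      using i by (simp add: sum.distrib)
    finally show ?thesis by simp
  qed
  then show thesis by (rule that)
qed

text \<open>
  The eigenvalue is the infimum \<open>T\<close> of the set \<open>P\<close> of all \<open>t\<close> with a positive \<open>x\<close> such that
  \<open>t x - B x \<ge> 1\<close>. This set is open, so \<open>T \<notin> P\<close>. If \<open>T\<close> were no eigenvalue, the solution of
  \<open>T x - B x = 1\<close> would be nonnegative by the monotonicity for \<open>t > T\<close> and witness \<open>T \<in> P\<close>.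
\<close>

lemma nonneg_mat_eigenvalue_ge:
  fixes B :: "real mat"
  assumes B: "B \<in> carrier_mat N N"
    and nonneg: "\<And>i j. i < N \<Longrightarrow> j < N \<Longrightarrow> 0 \<le> B $$ (i, j)"
    and z: "\<And>i. i < N \<Longrightarrow> 0 \<le> z i" "k < N" "0 < z k"
    and sub: "\<And>j. j < N \<Longrightarrow> \<mu> * z j \<le> (\<Sum>i<N. z i * B $$ (i, j))"
  shows "\<exists>t\<ge>\<mu>. eigenvalue B t"
proof -
  define R where "R = (\<lambda>t x. \<forall>i<N. 0 < x i \<and> (\<Sum>j<N. B $$ (i, j) * x j) + 1 \<le> t * (x i :: real))"
  define P where "P = {t. \<exists>x. R t x}"
  have R_mono: "R t' x" if "R t x" "t \<le> t'" for t t' x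
    using that unfolding R_def by (smt (verit) mult_right_mono)
  \<comment> \<open>The sum of all entries bounds every row sum, so the all-ones vector is a
    witness.\<close>
  have "1 + (\<Sum>i<N. \<Sum>j<N. B $$ (i, j)) \<in> P"
  proof -
    have "(\<Sum>j<N. B $$ (i, j)) \<le> (\<Sum>i<N. \<Sum>j<N. B $$ (i, j))" if "i < N" for i
      using that nonneg by (intro member_le_sum) (auto intro: sum_nonneg)
    then have "R (1 + (\<Sum>i<N. \<Sum>j<N. B $$ (i, j))) (\<lambda>_. 1)"
      unfolding R_def by auto
    then show ?thesis unfolding P_def by blast
  qed
  then have ne: "P \<noteq> {}" by blast
  \<comment> \<open>Pair the inequality for \<open>x\<close> with the left vector \<open>z\<close>;
    the pairing \<open>?zx\<close> is positive.\<close>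
  have lower: "\<mu> \<le> t" if "t \<in> P" for t
  proof -
    obtain x where x: "R t x" using \<open>t \<in> P\<close> unfolding P_def by blast
    let ?zx = "\<Sum>j<N. z j * x j"
    have "0 < z k * x k" using z x unfolding R_def by simp
    also have "\<dots> \<le> ?zx"
      using z x unfolding R_def by (intro member_le_sum) (auto intro!: mult_nonneg_nonneg simp: less_imp_le)
    finally have pos: "0 < ?zx" .
    have "\<mu> * ?zx = (\<Sum>j<N. \<mu> * z j * x j)" by (simp add: sum_distrib_left mult_ac)
    also have "\<dots> \<le> (\<Sum>j<N. (\<Sum>i<N. z i * B $$ (i, j)) * x j)"
      using sub x unfolding R_def by (intro sum_mono mult_right_mono) (auto simp: less_imp_le)
    also have "\<dots> = (\<Sum>i<N. \<Sum>j<N. z i * (B $$ (i, j) * x j))"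
      unfolding sum_distrib_right by (subst sum.swap) (simp add: mult_ac)
    also have "\<dots> = (\<Sum>i<N. z i * (\<Sum>j<N. B $$ (i, j) * x j))"
      by (simp add: sum_distrib_left)
    also have "\<dots> \<le> (\<Sum>i<N. z i * (t * x i))"
    proof (intro sum_mono mult_left_mono)
      fix i assume "i \<in> {..<N}"
      then have "(\<Sum>j<N. B $$ (i, j) * x j) + 1 \<le> t * x i" "0 \<le> z i"
        using x z(1) unfolding R_def by auto
      then show "(\<Sum>j<N. B $$ (i, j) * x j) \<le> t * x i" "0 \<le> z i" by linarith+
    qed
    also have "\<dots> = t * ?zx" by (simp add: sum_distrib_left mult_ac)
    finally show "\<mu> \<le> t" using pos by simp
  qed
  define T where "T = Inf P"
  have bdd: "bdd_below P" using lower by (meson bdd_belowI)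
  have "\<mu> \<le> T" unfolding T_def using ne lower by (intro cInf_greatest)
  have above: "t \<in> P" if t: "T < t" for t
  proof -
    obtain t' where "t' \<in> P" "t' < t" using cInf_lessD[OF ne, of t] t unfolding T_def by blast
    then show ?thesis unfolding P_def using R_mono[of t' _ t] by auto
  qed
  have "T \<notin> P"
  proof
    assume "T \<in> P"
    then obtain x where x: "R T x" unfolding P_def by blast
    \<comment> \<open>Doubling \<open>x\<close> doubles the slack 1; as \<open>M\<close> exceeds
      every \<open>x i\<close>, lowering \<open>T\<close> by \<open>1 / (2 * M)\<close> costs less
      than 1 of it.\<close>
    define M where "M = (\<Sum>i<N. x i) + 1"
    have xM: "x i < M" if "i < N" for i
      using member_le_sum[of i "{..<N}" x] x that unfolding R_def M_def by (force simp: less_imp_le)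
    have "0 < M" using xM[OF z(2)] x z(2) unfolding R_def by force
    have "R (T - 1 / (2 * M)) (\<lambda>i. 2 * x i)"
      unfolding R_def
    proof (intro allI impI conjI)
      fix i assume i: "i < N"
      show "0 < 2 * x i" using x i unfolding R_def by simp
      have "x i / M \<le> 1" using xM[OF i] \<open>0 < M\<close> by simp
      moreover have "(\<Sum>j<N. B $$ (i, j) * x j) + 1 \<le> T * x i" using x i unfolding R_def by simp
      moreover have "(\<Sum>j<N. B $$ (i, j) * (2 * x j)) = 2 * (\<Sum>j<N. B $$ (i, j) * x j)"
        by (simp add: sum_distrib_left mult_ac)
      moreover have "(T - 1 / (2 * M)) * (2 * x i) = 2 * (T * x i) - x i / M"
        using \<open>0 < M\<close> by (simp add: field_simps)
      ultimately show "(\<Sum>j<N. B $$ (i, j) * (2 * x j)) + 1 \<le> (T - 1 / (2 * M)) * (2 * x i)"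
        by linarith
    qed
    then have "T \<le> T - 1 / (2 * M)"
      unfolding T_def P_def by (intro cInf_lower) (use bdd in \<open>auto simp: P_def\<close>)
    then show False using \<open>0 < M\<close> by simp
  qed
  moreover have "T \<in> P" if notev: "\<not> eigenvalue B T"
  proof -
    obtain x where x: "\<And>i. i < N \<Longrightarrow> T * x i - (\<Sum>j<N. B $$ (i, j) * x j) = 1"
      using solvable_if_not_eigenvalue[OF B notev] by blast
    \<comment> \<open>As \<open>M\<close> exceeds every \<open>\<bar>x i\<bar>\<close>, raising
      \<open>T\<close> by \<open>1 / M\<close> costs \<open>x\<close> at most its slack 1.\<close>
    define M where "M = (\<Sum>i<N. \<bar>x i\<bar>) + 1"
    have xM: "\<bar>x i\<bar> < M" if "i < N" for i
      using member_le_sum[of i "{..<N}" "\<lambda>i. \<bar>x i\<bar>"] that unfolding M_def by force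
    have "0 < M" using xM[OF z(2)] by linarith
    then have "T + 1 / M \<in> P" by (intro above) simp
    then obtain y where y: "R (T + 1 / M) y" unfolding P_def by blast
    have x0: "0 \<le> x i" if "i < N" for i
    proof (rule M_matrix_monotone[where b = "\<lambda>i j. B $$ (i, j)" and y = y and t = "T + 1 / M" and N = N])
      fix i assume i: "i < N"
      have "-1 \<le> x i / M" using xM[OF i] \<open>0 < M\<close> by (simp add: field_simps)
      then show "(\<Sum>j<N. B $$ (i, j) * x j) \<le> (T + 1 / M) * x i"
        using x[OF i] by (simp add: algebra_simps)
    qed (use y nonneg that in \<open>auto simp: R_def\<close>)
    have "R T x"
      unfolding R_def
    proof (intro allI impI conjI)
      fix i assume i: "i < N"
      have "0 \<le> (\<Sum>j<N. B $$ (i, j) * x j)"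
        using nonneg x0 i by (intro sum_nonneg) auto
      \<comment> \<open>\<open>T * x i\<close> is at least 1, which rules out
        \<open>x i = 0\<close>.\<close>
      then have "T * x i \<noteq> 0" using x[OF i] by linarith
      then show "0 < x i" using x0[OF i] by (cases "x i = 0") auto
      show "(\<Sum>j<N. B $$ (i, j) * x j) + 1 \<le> T * x i" using x[OF i] by linarith
    qed
    then show ?thesis unfolding P_def by blast
  qed
  ultimately show ?thesis using \<open>\<mu> \<le> T\<close> by blast
qed

text \<open>The step vectors \<open>s j\<close> generate the cone. In their coordinates
  \<open>A\<close> becomes the nonnegative matrix \<open>B\<close>, and the functional
  \<open>p * v (N - 1) - q * v 0\<close> becomes a nonnegative left vector.\<close>

lemma monotone_cone_eigenvalue_ge:
  fixes A :: "real mat"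
  assumes A: "A \<in> carrier_mat N N" and N: "0 < N"
    and cone: "\<And>v. mono_on {..<N} v \<Longrightarrow> 0 \<le> v 0 \<Longrightarrow>
      mono_on {..<N} (\<lambda>i. \<Sum>j<N. A $$ (i, j) * v j) \<and> 0 \<le> (\<Sum>j<N. A $$ (0, j) * v j)"
    and pq: "0 \<le> q" "q < p"
    and sub: "\<And>v. mono_on {..<N} v \<Longrightarrow> 0 \<le> v 0 \<Longrightarrow>
      \<mu> * (p * v (N - 1) - q * v 0) \<le>
        p * (\<Sum>j<N. A $$ (N - 1, j) * v j) - q * (\<Sum>j<N. A $$ (0, j) * v j)"
  shows "\<exists>t\<ge>\<mu>. eigenvalue A t"
proof -
  define s where "s = (\<lambda>j i::nat. if j \<le> i then 1 else (0::real))"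
  \<comment> \<open>The columns of \<open>S\<close> are the step vectors; its inverse
    \<open>D\<close> takes backward differences.\<close>
  define S where "S = Matrix.mat N N (\<lambda>(i, j). s j i)"
  define D where "D = Matrix.mat N N
    (\<lambda>(i, k). (if i = k then 1 else 0) - (if i = Suc k then 1 else (0::real)))"
  define u where "u = (\<lambda>j i. \<Sum>k<N. A $$ (i, k) * s j k)"
  have carr: "S \<in> carrier_mat N N" "D \<in> carrier_mat N N"
    unfolding S_def D_def by auto
  have D_mult: "(D * M) $$ (i, j) = M $$ (i, j) - (if i = 0 then 0 else M $$ (i - 1, j))"
    if M: "M \<in> carrier_mat N N" and ij: "i < N" "j < N" for M i j
  proof -
    have "(D * M) $$ (i, j) = (\<Sum>k<N. D $$ (i, k) * M $$ (k, j))"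
      using M carr ij by (simp add: scalar_prod_def atLeast0LessThan)
    also have "\<dots> = (\<Sum>k<N. (if i = k then M $$ (k, j) else 0) - (if i = Suc k then M $$ (k, j) else 0))"
      using ij unfolding D_def by (intro sum.cong) auto
    also have "\<dots> = M $$ (i, j) - (\<Sum>k<N. if i = Suc k then M $$ (k, j) else 0)"
      using ij by (simp add: sum_subtractf)
    also have "(\<Sum>k<N. if i = Suc k then M $$ (k, j) else 0) = (if i = 0 then 0 else M $$ (i - 1, j))"
    proof (cases i)
      case (Suc m)
      have "(\<Sum>k<N. if i = Suc k then M $$ (k, j) else 0) = (\<Sum>k<N. if m = k then M $$ (k, j) else 0)"
        using Suc by (intro sum.cong) auto
      then show ?thesis using Suc ij by simp
    qed simp
    finally show ?thesis .
  qed
  have DS: "D * S = 1\<^sub>m N"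
  proof (rule eq_matI)
    fix i j assume "i < dim_row (1\<^sub>m N)" "j < dim_col (1\<^sub>m N)"
    then show "(D * S) $$ (i, j) = 1\<^sub>m N $$ (i, j)"
      using carr by (subst D_mult) (auto simp: S_def s_def)
  qed (use carr in auto)
  have SD: "S * D = 1\<^sub>m N" using mat_mult_left_right_inverse[OF carr(2,1) DS] .
  define B where "B = D * A * S"
  have B: "B \<in> carrier_mat N N" unfolding B_def using A carr by simp
  have AS: "(A * S) $$ (i, j) = u j i" if "i < N" "j < N" for i j
    using that A carr unfolding u_def S_def by (simp add: scalar_prod_def atLeast0LessThan)
  have B_entry: "B $$ (i, j) = u j i - (if i = 0 then 0 else u j (i - 1))" if "i < N" "j < N" for i j
  proof -
    have "B = D * (A * S)" unfolding B_def using A carr by (simp add: assoc_mult_mat)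
    then show ?thesis using D_mult[of "A * S" i j] A carr that AS by auto
  qed
  have s_cone: "mono_on {..<N} (s j)" "0 \<le> s j 0" for j
    unfolding s_def by (auto intro!: mono_onI)
  have u_cone: "mono_on {..<N} (u j)" "0 \<le> u j 0" for j
    using cone[OF s_cone] unfolding u_def by auto
  have "\<exists>t\<ge>\<mu>. eigenvalue B t"
  \<comment> \<open>\<open>z\<close> lists the functional on the step vectors: all of them end in 1,
    only \<open>s 0\<close> starts with 1.\<close>
  proof (rule nonneg_mat_eigenvalue_ge[OF B, where z = "\<lambda>i. p - (if i = 0 then q else 0)" and k = 0])
    fix i j assume "i < N" "j < N"
    then show "0 \<le> B $$ (i, j)"
      using u_cone[of j] mono_onD[of "{..<N}" "u j" "i - 1" i] by (auto simp: B_entry)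
  next
    fix j assume j: "j < N"
    have tele: "(\<Sum>i<Suc m. B $$ (i, j)) = u j m" if "m < N" for m
      using that by (induction m) (auto simp: B_entry j N)
    have "(\<Sum>i<N. (p - (if i = 0 then q else 0)) * B $$ (i, j)) =
        (\<Sum>i<N. p * B $$ (i, j) - (if i = 0 then q * B $$ (i, j) else 0))"
      by (intro sum.cong) (auto simp: algebra_simps)
    also have "\<dots> = p * (\<Sum>i<N. B $$ (i, j)) - q * B $$ (0, j)"
      using N by (simp add: sum_subtractf sum_distrib_left)
    also have "\<dots> = p * u j (N - 1) - q * u j 0"
      using tele[of "N - 1"] N j by (simp add: B_entry)
    finally have "(\<Sum>i<N. (p - (if i = 0 then q else 0)) * B $$ (i, j)) = p * u j (N - 1) - q * u j 0" .
    moreover have "p - (if j = 0 then q else 0) = p * s j (N - 1) - q * s j 0"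
      using j unfolding s_def by auto
    ultimately show "\<mu> * (p - (if j = 0 then q else 0)) \<le>
        (\<Sum>i<N. (p - (if i = 0 then q else 0)) * B $$ (i, j))"
      using sub[OF s_cone, of j] unfolding u_def by simp
  qed (use pq N in auto)
  moreover have "char_poly B = char_poly A"
    using A B carr DS SD unfolding B_def
    by (intro char_poly_similar similar_matI[where P = D and Q = S and n = N]) auto
  ultimately show ?thesis
    using eigenvalue_root_char_poly[OF A] eigenvalue_root_char_poly[OF B] by simp
qed

section \<open>Analytic and concave functions on \<open>[-1, 1]\<close>\<close>

text \<open>At an end point of \<open>unit_int\<close> the representation is one-sided, but
  convergence at one point at distance \<open>\<rho>\<close> forces it for all
  \<open>\<bar>h\<bar> < \<rho>\<close>.\<close>

lemma real_analytic_on_power_series: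
  assumes "real_analytic_on f unit_int" and x: "x \<in> unit_int"
  shows "\<exists>r>0. \<exists>c. (\<forall>h. \<bar>h\<bar> < r \<longrightarrow> summable (\<lambda>k. c k * h ^ k)) \<and>
    (\<forall>y\<in>unit_int. \<bar>y - x\<bar> < r \<longrightarrow> (\<lambda>k. c k * (y - x) ^ k) sums f y)"
proof -
  obtain r c where r: "0 < r"
    and c: "\<And>y. y \<in> unit_int \<Longrightarrow> \<bar>y - x\<bar> < r \<Longrightarrow> (\<lambda>k. c k * (y - x) ^ k) sums f y"
    using assms unfolding real_analytic_on_def by meson
  define \<rho> where "\<rho> = min (r / 2) 1"
  have \<rho>: "0 < \<rho>" "\<rho> < r" "\<rho> \<le> 1" unfolding \<rho>_def using r by auto
  \<comment> \<open>Moving right from \<open>x \<le> 0\<close>, or left from \<open>x > 0\<close>,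
    by at most 1 stays in the interval.\<close>
  define y where "y = (if x \<le> 0 then x + \<rho> else x - \<rho>)"
  have y: "y \<in> unit_int" "\<bar>y - x\<bar> = \<rho>"
    using x \<rho> unfolding y_def unit_int_def by auto
  have sm: "summable (\<lambda>k. c k * (y - x) ^ k)"
    using c[of y] y \<rho> by (intro sums_summable) auto
  have "summable (\<lambda>k. c k * h ^ k)" if "\<bar>h\<bar> < \<rho>" for h
    using powser_inside[OF sm, of h] y that by simp
  then show ?thesis using c \<rho> by (intro exI[of _ \<rho>] conjI exI[of _ c]) auto
qed

lemma deriv_I_eq:
  assumes "(f has_real_derivative d) (at x within unit_int)" "x \<in> unit_int"
  shows "deriv_I f x = d"
  using assms unfolding deriv_I_def unit_int_def
  by (intro vector_derivative_within_closed_interval)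
     (auto simp: has_real_derivative_iff_has_vector_derivative)

text \<open>Termwise differentiation holds on the whole disc; only afterwards is the series replaced
  by \<open>f\<close>, with which it agrees on \<open>unit_int\<close>.\<close>

lemma power_series_deriv_I:
  assumes r: "\<And>h. \<bar>h\<bar> < r \<Longrightarrow> summable (\<lambda>k. c k * h ^ k)"
    and c: "\<And>y. y \<in> unit_int \<Longrightarrow> \<bar>y - x\<bar> < r \<Longrightarrow> (\<lambda>k. c k * (y - x) ^ k) sums f y"
    and y: "y \<in> unit_int" "\<bar>y - x\<bar> < r"
  shows "(f has_real_derivative (\<Sum>k. diffs c k * (y - x) ^ k)) (at y within unit_int)"
proof -
  have "((\<lambda>z. \<Sum>k. c k * z ^ k) has_real_derivative (\<Sum>k. diffs c k * (y - x) ^ k)) (at (y - x))"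
    using r y by (intro termdiffs_strong'[where K = r]) auto
  then have "((\<lambda>z. \<Sum>k. c k * (z - x) ^ k) has_real_derivative (\<Sum>k. diffs c k * (y - x) ^ k)) (at y)"
    using DERIV_shift[of "\<lambda>z. \<Sum>k. c k * z ^ k" _ y "-x"] by simp
  then have "((\<lambda>z. \<Sum>k. c k * (z - x) ^ k) has_real_derivative (\<Sum>k. diffs c k * (y - x) ^ k))
      (at y within unit_int)"
    by (rule has_field_derivative_at_within)
  then show ?thesis
  proof (rule has_field_derivative_transform_within)
    fix z assume z: "z \<in> unit_int" "dist z y < r - \<bar>y - x\<bar>"
    then have "\<bar>z - x\<bar> < r" unfolding dist_real_def by linarith
    then show "(\<Sum>k. c k * (z - x) ^ k) = f z"
      using c[OF z(1)] sums_unique by metis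
  qed (use y in auto)
qed

lemma real_analytic_on_has_deriv_I:
  assumes "real_analytic_on f unit_int" "x \<in> unit_int"
  shows "(f has_real_derivative deriv_I f x) (at x within unit_int)"
proof -
  obtain r c where "0 < r" "\<And>h. \<bar>h\<bar> < r \<Longrightarrow> summable (\<lambda>k. c k * h ^ k)"
    "\<And>y. y \<in> unit_int \<Longrightarrow> \<bar>y - x\<bar> < r \<Longrightarrow> (\<lambda>k. c k * (y - x) ^ k) sums f y"
    using real_analytic_on_power_series[OF assms] by meson
  from power_series_deriv_I[OF this(2,3) assms(2)] this(1)
  have d: "(f has_real_derivative (\<Sum>k. diffs c k * (x - x) ^ k)) (at x within unit_int)" by simp
  then show ?thesis using deriv_I_eq[OF d assms(2)] by simp
qed

lemma real_analytic_on_deriv_I: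
  assumes "real_analytic_on f unit_int"
  shows "real_analytic_on (deriv_I f) unit_int"
  unfolding real_analytic_on_def
proof
  fix x assume x: "x \<in> unit_int"
  obtain r c where cr: "0 < r" "\<And>h. \<bar>h\<bar> < r \<Longrightarrow> summable (\<lambda>k. c k * h ^ k)"
    "\<And>y. y \<in> unit_int \<Longrightarrow> \<bar>y - x\<bar> < r \<Longrightarrow> (\<lambda>k. c k * (y - x) ^ k) sums f y"
    using real_analytic_on_power_series[OF assms x] by meson
  have "(\<lambda>k. diffs c k * (y - x) ^ k) sums deriv_I f y" if y: "y \<in> unit_int" "\<bar>y - x\<bar> < r" for y
  proof -
    have "summable (\<lambda>k. diffs c k * (y - x) ^ k)"
      using cr(2) y(2) by (intro termdiff_converges[where K = r]) auto
    moreover have "deriv_I f y = (\<Sum>k. diffs c k * (y - x) ^ k)"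
      using power_series_deriv_I[OF cr(2,3) y] y(1) by (intro deriv_I_eq)
    ultimately show ?thesis by (simp add: sums_iff)
  qed
  then show "\<exists>r>0. \<exists>c. \<forall>y\<in>unit_int. \<bar>y - x\<bar> < r \<longrightarrow> (\<lambda>k. c k * (y - x) ^ k) sums deriv_I f y"
    using cr(1) by blast
qed

text \<open>The limit at 0 from the right gives \<open>c 0 = v\<close>. Any further nonzero
  coefficient would make 0 an isolated zero of \<open>F h - v\<close>, which vanishes for all small
  \<open>h > 0\<close>.\<close>

lemma power_series_const_right:
  fixes c :: "nat \<Rightarrow> real"
  assumes r: "0 < r" "\<And>h. \<bar>h\<bar> < r \<Longrightarrow> summable (\<lambda>k. c k * h ^ k)"
    and v: "0 < e" "\<And>h. 0 < h \<Longrightarrow> h < e \<Longrightarrow> (\<lambda>k. c k * h ^ k) sums v"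
  shows "c k = (if k = 0 then v else 0)"
proof -
  define F where "F = (\<lambda>h. \<Sum>k. c k * h ^ k)"
  have F: "(\<lambda>k. c k * h ^ k) sums F h" if "\<bar>h\<bar> < r" for h
    using r(2)[OF that] unfolding F_def by (rule summable_sums)
  have Fv: "F h = v" if "0 < h" "h < e" for h
    using v(2)[OF that] unfolding F_def by (simp add: sums_iff)
  have "(F \<longlongrightarrow> c 0) (at 0)"
    using F r(1) by (intro powser_limit_0[where s = r]) auto
  then have "(F \<longlongrightarrow> c 0) (at_right 0)" by (simp add: filterlim_at_split)
  moreover have "(F \<longlongrightarrow> v) (at_right 0)"
    using Fv v(1) by (intro tendsto_eventually) (auto simp: eventually_at_right_field)
  ultimately have c0: "c 0 = v" by (intro tendsto_unique[of "at_right (0::real)"]) auto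
  have "c m = 0" if "0 < m" for m
  proof (rule ccontr)
    assume m: "c m \<noteq> 0"
    have "(\<lambda>k. (c(0 := 0)) k * (h - 0) ^ k) sums (F h - v)" if h: "norm (h - 0) < r" for h
    proof -
      have "(\<lambda>k. c k * h ^ k - (if k = 0 then v else 0)) sums (F h - v)"
        using h by (intro sums_diff F sums_single) auto
      also have "(\<lambda>k. c k * h ^ k - (if k = 0 then v else 0)) = (\<lambda>k. (c(0 := 0)) k * (h - 0) ^ k)"
        using c0 by auto
      finally show ?thesis .
    qed
    moreover have "F 0 - v = 0" unfolding F_def using c0 by simp
    ultimately obtain s where s: "0 < s" "\<And>z. z \<in> cball 0 s - {0} \<Longrightarrow> F z - v \<noteq> 0"
      using powser_0_nonzero[of r 0 "c(0 := 0)" "\<lambda>h. F h - v" m] r(1) m \<open>0 < m\<close> by auto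
    define h where "h = min s (e / 2)"
    have "0 < h" "h \<le> s" "h < e" unfolding h_def using s(1) v(1) by (auto simp: min_def)
    then show False using s(2)[of h] Fv[of h] by auto
  qed
  then show ?thesis using c0 by auto
qed

text \<open>An identity theorem. Let \<open>m\<close> be the infimum of all points from which
  \<open>f\<close> equals \<open>v\<close> up to 1. Its values on the right make the series at
  \<open>m\<close> constant, so constancy continues to the left unless
  \<open>m = -1\<close>.\<close>

lemma real_analytic_on_const_extend:
  assumes f: "real_analytic_on f unit_int"
    and b: "-1 \<le> b" "b < 1" "\<And>y. y \<in> {b..1} \<Longrightarrow> f y = v"
    and x: "x \<in> unit_int"
  shows "f x = v"
proof -
  define M where "M = {m \<in> unit_int. \<forall>y\<in>{m..1}. f y = v}"
  have bM: "b \<in> M" using b unfolding M_def unit_int_def by auto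
  have bdd: "bdd_below M" unfolding M_def unit_int_def by auto
  define m where "m = Inf M"
  have m: "-1 \<le> m" "m \<le> b"
    unfolding m_def using bM bdd by (auto intro!: cInf_greatest cInf_lower simp: M_def unit_int_def)
  have right: "f y = v" if y: "m < y" "y \<le> 1" for y
  proof -
    obtain m' where "m' \<in> M" "m' < y" using cInf_lessD[of M y] bM y unfolding m_def by blast
    then show ?thesis using y unfolding M_def by auto
  qed
  have mI: "m \<in> unit_int" using m b unfolding unit_int_def by auto
  obtain r c where cr: "0 < r" "\<And>h. \<bar>h\<bar> < r \<Longrightarrow> summable (\<lambda>k. c k * h ^ k)"
    "\<And>y. y \<in> unit_int \<Longrightarrow> \<bar>y - m\<bar> < r \<Longrightarrow> (\<lambda>k. c k * (y - m) ^ k) sums f y"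
    using real_analytic_on_power_series[OF f mI] by meson
  have c: "c k = (if k = 0 then v else 0)" for k
  proof (rule power_series_const_right[OF cr(1,2)])
    fix h :: real assume h: "0 < h" "h < min r (1 - m)"
    then have "(\<lambda>k. c k * (m + h - m) ^ k) sums f (m + h)"
      using m by (intro cr(3)) (auto simp: unit_int_def)
    then show "(\<lambda>k. c k * h ^ k) sums v" using right[of "m + h"] h by simp
  qed (use cr m b in auto)
  have near: "f y = v" if "y \<in> unit_int" "\<bar>y - m\<bar> < r" for y
  proof -
    have "(\<lambda>k. c k * (y - m) ^ k) = (\<lambda>k. if k = 0 then v else 0)" using c by auto
    moreover have "(\<lambda>k. if k = 0 then v else 0) sums v" by (rule sums_single)
    ultimately show ?thesis using cr(3)[OF that] sums_unique2 by metis
  qed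
  have "m = -1"
  proof (rule ccontr)
    assume "m \<noteq> -1"
    define m' where "m' = max (-1) (m - r / 2)"
    have m': "m' < m" "-1 \<le> m'" "m - m' < r" unfolding m'_def using \<open>m \<noteq> -1\<close> m cr(1) by auto
    have "m' \<in> M"
      unfolding M_def
    proof (intro CollectI conjI ballI)
      fix y assume "y \<in> {m'..1}"
      then show "f y = v"
        using right[of y] near[of y] m' m b by (cases "m < y") (auto simp: unit_int_def)
    qed (use m' m b in \<open>auto simp: unit_int_def\<close>)
    then have "m \<le> m'" unfolding m_def using bdd by (rule cInf_lower)
    then show False using m' by simp
  qed
  then show ?thesis
    using right[of x] near[of x] x cr(1) by (cases "x = m") (auto simp: unit_int_def)
qed

text \<open>Along the segment from \<open>x\<close> to \<open>y\<close> the difference quotients at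
  \<open>x\<close> dominate that of the whole segment; the bound passes to their limit.\<close>

lemma concave_on_le_tangent:
  fixes f :: "real \<Rightarrow> real"
  assumes f: "concave_on S f" and d: "(f has_real_derivative d) (at x within S)"
    and xy: "x \<in> S" "y \<in> S"
  shows "f y \<le> f x + d * (y - x)"
proof -
  define \<phi> where "\<phi> = (\<lambda>t. f (x + t * (y - x)))"
  have S: "convex S" using f by (simp add: concave_on_def convex_on_imp_convex)
  have seg: "x + t * (y - x) = (1 - t) *\<^sub>R x + t *\<^sub>R y" for t by (simp add: algebra_simps)
  have inS: "x + t * (y - x) \<in> S" if "t \<in> {0..1}" for t
    unfolding seg using S xy that by (intro convexD) auto
  have conc: "f x + t * (f y - f x) \<le> \<phi> t" if "t \<in> {0..1}" for t
  proof -
    have "(1 - t) * f x + t * f y \<le> f ((1 - t) *\<^sub>R x + t *\<^sub>R y)"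
      using f xy that by (auto simp: concave_on_iff)
    then show ?thesis unfolding \<phi>_def seg by (simp add: algebra_simps)
  qed
  have "(\<phi> has_real_derivative d * (y - x)) (at 0 within {0..1})"
  proof -
    have "((\<lambda>t. x + t * (y - x)) has_real_derivative (y - x)) (at 0 within {0..1})"
      by (auto intro!: derivative_eq_intros)
    moreover have "(f has_real_derivative d) (at (x + 0 * (y - x)) within (\<lambda>t. x + t * (y - x)) ` {0..1})"
      using d inS by (auto intro: has_field_derivative_subset)
    ultimately have "(f \<circ> (\<lambda>t. x + t * (y - x)) has_real_derivative d * (y - x)) (at 0 within {0..1})"
      by (intro DERIV_image_chain)
    then show ?thesis unfolding \<phi>_def by (simp add: o_def)
  qed
  then have lim: "((\<lambda>t. (\<phi> t - \<phi> 0) / (t - 0)) \<longlongrightarrow> d * (y - x)) (at 0 within {0..1})"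
    by (simp add: has_field_derivative_iff)
  have "f y - f x \<le> d * (y - x)"
  proof (rule tendsto_lowerbound[OF lim])
    have "f y - f x \<le> (\<phi> t - \<phi> 0) / (t - 0)" if "t \<in> {0..1}" "t \<noteq> 0" for t
      using conc[OF that(1)] that by (simp add: field_simps \<phi>_def)
    then show "\<forall>\<^sub>F t in at 0 within {0..1}. f y - f x \<le> (\<phi> t - \<phi> 0) / (t - 0)"
      unfolding eventually_at_filter by simp
  qed (simp add: at_within_Icc_at_right)
  then show ?thesis by simp
qed

text \<open>Add the tangent inequalities at \<open>x\<close> and \<open>y\<close>. The case
  \<open>x = y\<close> is separate because a derivative within \<open>S\<close> is not unique at an
  isolated point.\<close>

lemma concave_on_deriv_antimono:
  fixes f :: "real \<Rightarrow> real"
  assumes f: "concave_on S f" and xy: "x \<in> S" "y \<in> S" "x \<le> y"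
    and d: "(f has_real_derivative d) (at x within S)" "(f has_real_derivative e) (at y within S)"
  shows "e \<le> d \<or> x = y"
proof -
  have "f y \<le> f x + d * (y - x)" "f x \<le> f y + e * (x - y)"
    using concave_on_le_tangent[OF f d(1)] concave_on_le_tangent[OF f d(2)] xy by auto
  then have "0 \<le> (d - e) * (y - x)" by (simp add: algebra_simps)
  then show ?thesis using xy(3) by (auto simp: zero_le_mult_iff)
qed

section \<open>Finite families of disjoint compact intervals\<close>

text \<open>Nonempty compact connected sets of reals are the compact intervals, points included;
  this form passes directly to continuous images.\<close>

definition interval_family :: "real set set \<Rightarrow> bool" where
  "interval_family F \<longleftrightarrow> finite F \<and> disjoint F \<and> (\<forall>K\<in>F. K \<noteq> {} \<and> compact K \<and> connected K)"

text \<open>The union of the other members is closed, so a connected subset of the union that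
  contains \<open>K\<close> cannot reach beyond \<open>K\<close>. Every point lies in some member,
  which leaves no further components.\<close>

lemma components_Union_interval_family:
  assumes F: "interval_family F"
  shows "components (\<Union>F) = F"
proof -
  have comp: "K \<in> components (\<Union>F)" if K: "K \<in> F" for K
    unfolding in_components_maximal
  proof (intro conjI allI impI)
    fix D assume D: "D \<noteq> {} \<and> K \<subseteq> D \<and> D \<subseteq> \<Union>F \<and> connected D"
    have "closed K" "closed (\<Union>(F - {K}))" "K \<noteq> {}"
      using F K unfolding interval_family_def by (auto intro: compact_imp_closed)
    moreover have "K \<inter> \<Union>(F - {K}) = {}"
      using F K unfolding interval_family_def disjoint_def by blast
    moreover have "D \<subseteq> K \<union> \<Union>(F - {K})" using D by blast
    ultimately have "\<Union>(F - {K}) \<inter> D = {}"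
      using connected_closedD[of D K "\<Union>(F - {K})"] D by blast
    then show "D = K" using D by blast
  qed (use F K in \<open>auto simp: interval_family_def\<close>)
  moreover have "C \<in> F" if C: "C \<in> components (\<Union>F)" for C
  proof -
    obtain x where x: "x \<in> C" using in_components_nonempty[OF C] by blast
    then obtain K where "K \<in> F" "x \<in> K" using in_components_subset[OF C] by blast
    then show ?thesis using components_nonoverlap[OF C comp[of K]] x by blast
  qed
  ultimately show ?thesis by blast
qed

lemma (in linorder) sorted_key_list_of_set_inj_on:
  assumes "inj_on f S" "finite S"
  shows "set (sorted_key_list_of_set f S) = S"
    and "length (sorted_key_list_of_set f S) = card S"
    and "sorted_wrt (<) (map f (sorted_key_list_of_set f S))"
proof -
  interpret folding_insort_key "(\<le>)" "(<)" S f by unfold_locales (fact assms)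
  show "set (sorted_key_list_of_set f S) = S"
    and "length (sorted_key_list_of_set f S) = card S"
    and "sorted_wrt (<) (map f (sorted_key_list_of_set f S))"
    using assms by simp_all
qed

text \<open>Disjoint members have different infima, so \<open>Inf\<close> is an injective key. If
  \<open>y \<le> x\<close>, then \<open>y\<close> lies between \<open>Inf (L ! i)\<close> and
  \<open>x\<close>, hence in two members.\<close>

lemma interval_family_sorted:
  assumes F: "interval_family F"
  defines "L \<equiv> sorted_key_list_of_set Inf F"
  shows "set L = F" "length L = card F"
    and "\<And>i j x y. i < j \<Longrightarrow> j < card F \<Longrightarrow> x \<in> L ! i \<Longrightarrow> y \<in> L ! j \<Longrightarrow> x < y"
proof -
  have Inf_in: "Inf K \<in> K" and Inf_le: "x \<in> K \<Longrightarrow> Inf K \<le> x" if "K \<in> F" for K x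
    using F that unfolding interval_family_def
    by (auto intro!: closed_contains_Inf cInf_lower compact_imp_closed
        bounded_imp_bdd_below compact_imp_bounded)
  have inj: "inj_on Inf F"
  proof (rule inj_onI)
    fix K K' assume "K \<in> F" "K' \<in> F" "Inf K = Inf K'"
    then have "Inf K \<in> K \<inter> K'" using Inf_in[of K] Inf_in[of K'] by simp
    then show "K = K'" using F \<open>K \<in> F\<close> \<open>K' \<in> F\<close> unfolding interval_family_def disjoint_def by blast
  qed
  have fin: "finite F" using F by (simp add: interval_family_def)
  note L = sorted_key_list_of_set_inj_on[OF inj fin, folded L_def]
  show set: "set L = F" and len: "length L = card F" by (fact L)+
  fix i j x y assume ij: "i < j" "j < card F" and xy: "x \<in> L ! i" "y \<in> L ! j"
  have K: "L ! i \<in> F" "L ! j \<in> F" using ij len set nth_mem by fastforce+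
  have lt: "Inf (L ! i) < Inf (L ! j)"
    using sorted_wrt_nth_less[OF L(3), of i j] ij len by simp
  show "x < y"
  proof (rule ccontr)
    assume "\<not> x < y"
    moreover have "Inf (L ! i) \<le> y" using lt Inf_le[OF K(2) xy(2)] by linarith
    moreover have "connected (L ! i)" using F K(1) unfolding interval_family_def by blast
    ultimately have "y \<in> L ! i"
      using connectedD_interval[of "L ! i" "Inf (L ! i)" x y] Inf_in[OF K(1)] xy(1) by auto
    then have "L ! i = L ! j" using xy F K unfolding interval_family_def disjoint_def by blast
    then show False using lt by simp
  qed
qed

text \<open>A member of \<open>F0\<close> at position \<open>k \<ge> M\<close> would force all
  earlier positions into \<open>F0\<close>, which makes \<open>k + 1 > M\<close> distinct
  members.\<close>

lemma interval_family_upper_half: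
  assumes F: "interval_family (F0 \<union> F1)" and card: "card F0 = M" "card (F0 \<union> F1) = 2 * M"
    and less: "\<And>x y. x \<in> \<Union>F0 \<Longrightarrow> y \<in> \<Union>F1 \<Longrightarrow> x < y"
    and k: "M \<le> k" "k < 2 * M"
  shows "sorted_key_list_of_set Inf (F0 \<union> F1) ! k \<in> F1"
proof (rule ccontr)
  let ?L = "sorted_key_list_of_set Inf (F0 \<union> F1)"
  note L = interval_family_sorted[OF F]
  have mem: "?L ! i \<in> F0 \<union> F1" if "i < 2 * M" for i
    using that L(1,2) card nth_mem by metis
  assume "?L ! k \<notin> F1"
  then have k0: "?L ! k \<in> F0" using mem[OF k(2)] by blast
  have low: "?L ! i \<in> F0" if i: "i \<le> k" for i
  proof (rule ccontr)
    assume n: "?L ! i \<notin> F0"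
    then have 1: "?L ! i \<in> F1" and "i < k" using mem[of i] k k0 i by (auto simp: order_le_less)
    obtain x y where xy: "x \<in> ?L ! k" "y \<in> ?L ! i"
      using F k0 1 unfolding interval_family_def by blast
    have "x < y" using less k0 1 xy by blast
    moreover have "y < x" using L(3)[OF \<open>i < k\<close> _ xy(2,1)] k card by simp
    ultimately show False by simp
  qed
  have "inj_on ((!) ?L) {..k}"
  proof (rule linorder_inj_onI')
    fix i j assume ij: "i \<in> {..k}" "j \<in> {..k}" "i < j"
    obtain y where y: "y \<in> ?L ! j"
      using F mem[of j] ij k unfolding interval_family_def by force
    show "?L ! i \<noteq> ?L ! j"
      using L(3)[OF ij(3), of y y] y ij k card by auto
  qed
  then have "card {..k} \<le> card F0"
    using F low by (intro card_inj_on_le) (auto simp: interval_family_def)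
  then show False using card k by simp
qed

text \<open>By compactness of \<open>{a..b}\<close> the injective \<open>f\<close> has a continuous
  inverse on its image, and the members are transported along it.\<close>

lemma interval_family_preimage:
  fixes f :: "real \<Rightarrow> real"
  assumes F: "interval_family F" and f: "continuous_on {a..b} f" "inj_on f {a..b}"
    and sub: "\<Union>F \<subseteq> f ` {a..b}"
  shows "\<exists>F'. interval_family F' \<and> card F' = card F \<and> \<Union>F' = {x \<in> {a..b}. f x \<in> \<Union>F}"
proof -
  define \<tau> where "\<tau> = inv_into {a..b} f"
  have \<tau>: "continuous_on (f ` {a..b}) \<tau>"
    unfolding \<tau>_def using f by (intro continuous_on_inv) auto
  have inj: "inj_on \<tau> (\<Union>F)"
    unfolding \<tau>_def using sub by (rule inj_on_inv_into)
  have im: "inj_on ((`) \<tau>) F"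
    using inj by (auto intro!: inj_onI simp: inj_on_image_eq_iff Union_upper)
  have eq: "\<tau> ` K = {x \<in> {a..b}. f x \<in> K}" if "K \<in> F" for K
  proof -
    have "K \<subseteq> f ` {a..b}" using sub that by blast
    then show ?thesis unfolding \<tau>_def using f(2)
      by (auto simp: image_iff f_inv_into_f inv_into_into subset_iff) (metis inv_into_f_f atLeastAtMost_iff)+
  qed
  have "interval_family ((`) \<tau> ` F)"
    unfolding interval_family_def
  proof (intro conjI ballI)
    show "finite ((`) \<tau> ` F)" using F by (simp add: interval_family_def)
    show "disjoint ((`) \<tau> ` F)"
      unfolding disjoint_def
    proof (intro ballI impI)
      fix A B assume "A \<in> (`) \<tau> ` F" "B \<in> (`) \<tau> ` F" "A \<noteq> B"
      then obtain K K' where K: "K \<in> F" "K' \<in> F" "A = \<tau> ` K" "B = \<tau> ` K'" "K \<noteq> K'" by blast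
      then have "K \<inter> K' = {}" using F unfolding interval_family_def disjoint_def by blast
      then show "A \<inter> B = {}" unfolding K(3,4) eq[OF K(1)] eq[OF K(2)] by blast
    qed
  next
    fix A assume "A \<in> (`) \<tau> ` F"
    then obtain K where K: "K \<in> F" "A = \<tau> ` K" by blast
    have "continuous_on K \<tau>" using K sub by (intro continuous_on_subset[OF \<tau>]) blast
    then show "A \<noteq> {}" "compact A" "connected A"
      using F K unfolding interval_family_def
      by (auto intro: compact_continuous_image connected_continuous_image)
  qed
  moreover have "card ((`) \<tau> ` F) = card F" using im by (rule card_image)
  moreover have "\<Union>((`) \<tau> ` F) = {x \<in> {a..b}. f x \<in> \<Union>F}" using eq by auto
  ultimately show ?thesis by blast
qed

section \<open>The Feigenbaum map\<close>

lemma DERIV_chain_within: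
  assumes "(f has_real_derivative D) (at (k x) within S)" "(k has_real_derivative E) (at x within S)"
    and "k ` S \<subseteq> S"
  shows "((\<lambda>x. f (k x)) has_real_derivative D * E) (at x within S)"
  using DERIV_image_chain[of f D k x S E] has_field_derivative_subset[OF assms(1,3)] assms(2)
  by (simp add: o_def)

locale concave_feigenbaum =
  fixes g :: "real \<Rightarrow> real"
  assumes feigenbaum: "feigenbaum_map g" and concave: "concave_on {-1..1} g"
begin

section \<open>The scaling constant and the orbit of 1\<close>

abbreviation \<alpha> :: real where "\<alpha> \<equiv> alpha g"

text \<open>The third iterate of the critical point, and the left end point of
  \<open>J1 g\<close>.\<close>

abbreviation c :: real where "c \<equiv> g (g 1)"

lemma maps_to: "x \<in> unit_int \<Longrightarrow> g x \<in> unit_int"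
  using feigenbaum unfolding feigenbaum_map_def folding_map_def by blast

lemma even: "x \<in> unit_int \<Longrightarrow> g (- x) = g x"
  using feigenbaum unfolding feigenbaum_map_def by blast

lemma g_0: "g 0 = 1"
  using feigenbaum unfolding feigenbaum_map_def by blast

lemma iterates: "(g ^^ 2) x = g (g x)" "(g ^^ 3) x = g (g (g x))" "(g ^^ 4) x = g (g (g (g x)))"
  by (simp_all add: eval_nat_numeral)

text \<open>Since \<open>g 0 = 1\<close>, the order of the critical orbit becomes an order among
  \<open>g 1\<close>, \<open>c\<close> and \<open>g c\<close>.\<close>

lemma orbit: "g 1 < 0" "- g 1 < c" "0 < g c" "g c < - g 1"
  using feigenbaum unfolding feigenbaum_map_def iterates g_0 by linarith+

lemma c_le_1: "c \<le> 1"
  using maps_to[OF maps_to, of 1] by (simp add: unit_int_def)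

lemma alpha_gt_1: "1 < \<alpha>"
  using orbit c_le_1 unfolding alpha_def by (simp add: field_simps)

lemma g_1: "g 1 = - (1 / \<alpha>)"
  using orbit unfolding alpha_def by simp

lemma inv_alpha: "0 < 1 / \<alpha>" "1 / \<alpha> < c"
  using orbit g_1 by linarith+

lemma c_pos: "0 < c"
  using inv_alpha by linarith

lemma div_alpha_in: "x \<in> unit_int \<Longrightarrow> x / \<alpha> \<in> unit_int"
proof -
  assume x: "x \<in> unit_int"
  have "\<bar>x / \<alpha>\<bar> \<le> \<bar>x\<bar>" using alpha_gt_1 mult_right_mono[of 1 \<alpha> "\<bar>x\<bar>"] by (simp add: abs_divide field_simps)
  moreover have "\<bar>x\<bar> \<le> 1" using x unfolding unit_int_def by auto
  ultimately have "- 1 \<le> x / \<alpha> \<and> x / \<alpha> \<le> 1" by linarith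
  then show ?thesis unfolding unit_int_def by simp
qed

lemma fixed_point:
  assumes x: "x \<in> unit_int"
  shows "g x = - \<alpha> * g (g (x / \<alpha>))"
proof -
  have "g x = - \<alpha> * g (g (- x / \<alpha>))" using feigenbaum x unfolding feigenbaum_map_def by blast
  then show ?thesis using even[OF div_alpha_in[OF x]] by simp
qed

lemma g_inv_alpha: "g (1 / \<alpha>) = c"
  using even[of "g 1"] maps_to[of 1] g_1 by (simp add: unit_int_def)

text \<open>By \<open>g_inv_alpha\<close> the fixed point equation at 1 reads
  \<open>g 1 = - \<alpha> * g c\<close>. The value \<open>g c\<close> is the right end point of
  \<open>J0 g\<close>.\<close>

lemma g_c: "g c = (1 / \<alpha>) / \<alpha>"
proof -
  have "g 1 = - \<alpha> * g c" using fixed_point[of 1] by (simp add: unit_int_def g_inv_alpha)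
  then have "g c = - g 1 / \<alpha>" using alpha_gt_1 by (simp add: field_simps)
  also have "\<dots> = (1 / \<alpha>) / \<alpha>" by (simp only: g_1 minus_minus)
  finally show ?thesis .
qed

lemma sigma_c: "- \<alpha> * g c = - (1 / \<alpha>)"
  using alpha_gt_1 unfolding g_c by simp

lemma sigma_1: "- \<alpha> * g 1 = 1"
  using alpha_gt_1 g_1 by simp

section \<open>The derivative of \<open>g\<close>\<close>

abbreviation d :: "real \<Rightarrow> real" where "d \<equiv> deriv_I g"

lemma analytic: "real_analytic_on g unit_int"
  using feigenbaum unfolding feigenbaum_map_def by blast

lemma has_d: "x \<in> unit_int \<Longrightarrow> (g has_real_derivative d x) (at x within unit_int)"
  by (rule real_analytic_on_has_deriv_I[OF analytic])

lemma continuous_g: "continuous_on unit_int g"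
  using has_d by (rule DERIV_continuous_on)

lemma critical: "d 0 = 0" "deriv_I d 0 \<noteq> 0"
  using feigenbaum unfolding feigenbaum_map_def unique_nondegenerate_critical_point_def by auto

lemma has_deriv_div_alpha:
  assumes "x \<in> unit_int" "(f has_real_derivative D) (at (x / \<alpha>) within unit_int)"
  shows "((\<lambda>x. f (x / \<alpha>)) has_real_derivative D / \<alpha>) (at x within unit_int)"
proof -
  have "((\<lambda>x. x / \<alpha>) has_real_derivative 1 / \<alpha>) (at x within unit_int)"
    by (rule DERIV_cdivide[OF DERIV_ident])
  from DERIV_chain_within[OF assms(2) this] show ?thesis using div_alpha_in by auto
qed

text \<open>Chain rule in the fixed point equation; the outer factor \<open>\<alpha>\<close> cancels
  the inner \<open>1 / \<alpha>\<close>.\<close>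

lemma d_fixed_point:
  assumes x: "x \<in> unit_int"
  shows "d x = - (d (g (x / \<alpha>)) * d (x / \<alpha>))"
proof (rule deriv_I_eq[OF _ x])
  let ?y = "x / \<alpha>"
  have y: "?y \<in> unit_int" using x by (rule div_alpha_in)
  have "((\<lambda>x. g (g x)) has_real_derivative d (g ?y) * d ?y) (at ?y within unit_int)"
    using maps_to y by (intro DERIV_chain_within[of g _ g, OF has_d has_d]) auto
  then have "((\<lambda>x. g (g (x / \<alpha>))) has_real_derivative d (g ?y) * d ?y / \<alpha>) (at x within unit_int)"
    by (rule has_deriv_div_alpha[OF x])
  then have "((\<lambda>x. - \<alpha> * g (g (x / \<alpha>))) has_real_derivative - \<alpha> * (d (g ?y) * d ?y / \<alpha>))
      (at x within unit_int)"
    by (rule DERIV_cmult)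
  then have "((\<lambda>x. - \<alpha> * g (g (x / \<alpha>))) has_real_derivative - (d (g ?y) * d ?y))
      (at x within unit_int)"
    using alpha_gt_1 by simp
  then show "(g has_real_derivative - (d (g ?y) * d ?y)) (at x within unit_int)"
  proof (rule has_field_derivative_transform_within[where d = 1])
    fix y assume "y \<in> unit_int"
    then show "- \<alpha> * g (g (y / \<alpha>)) = g y" by (rule fixed_point[symmetric])
  qed (use x in auto)
qed

text \<open>Differentiating the fixed point equation twice at the critical point gives \<open>g'(1) = -\<alpha>\<close>.\<close>

lemma d_1: "d 1 = - \<alpha>"
proof -
  have 0: "0 \<in> unit_int" "1 \<in> unit_int" by (auto simp: unit_int_def)
  define e where "e = deriv_I d"
  have e: "(d has_real_derivative e x) (at x within unit_int)" if "x \<in> unit_int" for x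
    unfolding e_def using that by (intro real_analytic_on_has_deriv_I real_analytic_on_deriv_I analytic)
  have "((\<lambda>x. d (g x)) has_real_derivative e (g 0) * d 0) (at 0 within unit_int)"
    using maps_to 0 by (intro DERIV_chain_within[of d _ g, OF e has_d]) auto
  \<comment> \<open>Since \<open>d 0 = 0\<close>, the first factor has derivative 0, and the product
    rule keeps only the derivative of the second.\<close>
  then have u: "((\<lambda>x. d (g (x / \<alpha>))) has_real_derivative 0) (at 0 within unit_int)"
    using has_deriv_div_alpha[OF 0(1), of "\<lambda>x. d (g x)" "e (g 0) * d 0"] critical(1) by simp
  have w: "((\<lambda>x. d (x / \<alpha>)) has_real_derivative e 0 / \<alpha>) (at 0 within unit_int)"
    using has_deriv_div_alpha[OF 0(1), of d "e 0"] e[OF 0(1)] by simp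
  have "((\<lambda>x. - (d (g (x / \<alpha>)) * d (x / \<alpha>))) has_real_derivative - (d 1 * (e 0 / \<alpha>)))
      (at 0 within unit_int)"
    using DERIV_minus[OF DERIV_mult[OF u w]] g_0 by (simp add: mult.commute)
  then have "(d has_real_derivative - (d 1 * (e 0 / \<alpha>))) (at 0 within unit_int)"
  proof (rule has_field_derivative_transform_within[where d = 1])
    fix y assume "y \<in> unit_int"
    then show "- (d (g (y / \<alpha>)) * d (y / \<alpha>)) = d y" by (rule d_fixed_point[symmetric])
  qed (use 0 in auto)
  then have "e 0 = - (d 1 * (e 0 / \<alpha>))"
    unfolding e_def using 0 by (intro deriv_I_eq)
  \<comment> \<open>The factor \<open>e 0\<close> is nonzero because the critical point is
    non-degenerate.\<close>
  then have "e 0 * (d 1 + \<alpha>) = 0" using alpha_gt_1 by (simp add: field_simps)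
  then show ?thesis using critical(2) unfolding e_def[symmetric] by simp
qed

lemma d_antimono:
  assumes "x \<in> unit_int" "y \<in> unit_int" "x \<le> y"
  shows "d y \<le> d x"
proof -
  have "d y \<le> d x \<or> x = y"
    by (rule concave_on_deriv_antimono[OF concave[folded unit_int_def] assms has_d[OF assms(1)] has_d[OF assms(2)]])
  then show ?thesis by auto
qed

lemma d_nonpos: "x \<in> {0..1} \<Longrightarrow> d x \<le> 0"
  using d_antimono[of 0 x] critical(1) by (auto simp: unit_int_def)

text \<open>The fixed point equation at \<open>1\<close> reads \<open>|g'(c)| |g'(1/\<alpha>)| = \<alpha>\<close>, and the second factor is the
  smaller one because \<open>1/\<alpha> < c\<close>.\<close>

lemma d_c: "d c \<le> -1"
proof -
  have I: "1 / \<alpha> \<in> unit_int" "c \<in> unit_int" "1 / \<alpha> \<in> {0..1}"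
    unfolding unit_int_def atLeastAtMost_iff using inv_alpha c_le_1 by linarith+
  have "d c * d (1 / \<alpha>) = \<alpha>"
    using d_fixed_point[of 1] d_1 g_inv_alpha by (simp add: unit_int_def)
  moreover have "d c \<le> d (1 / \<alpha>)" "d (1 / \<alpha>) \<le> 0"
    using d_antimono[OF I(1,2)] inv_alpha d_nonpos[OF I(3)] by auto
  \<comment> \<open>Replacing the smaller factor by the larger one shows that the square of
    \<open>- d c\<close> is at least \<open>\<alpha>\<close>.\<close>
  ultimately have "1 < (- d c) * (- d c)"
    using alpha_gt_1 mult_left_mono[of "- d (1 / \<alpha>)" "- d c" "- d c"] by simp
  then show ?thesis
    using \<open>d c \<le> d (1 / \<alpha>)\<close> \<open>d (1 / \<alpha>) \<le> 0\<close> mult_le_one[of "- d c" "- d c"] by (cases "d c \<le> -1") auto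
qed

text \<open>Otherwise monotonicity squeezes \<open>d\<close> to the constant
  \<open>d 1 = - \<alpha>\<close> on \<open>{b..1}\<close>, and analyticity carries this value to 0,
  where \<open>d\<close> vanishes.\<close>

lemma d_gt_minus_alpha:
  assumes "-1 \<le> b" "b < 1"
  shows "- \<alpha> < d b"
proof (rule ccontr)
  assume b: "\<not> - \<alpha> < d b"
  have "d y = - \<alpha>" if "y \<in> {b..1}" for y
    using d_antimono[of b y] d_antimono[of y 1] b d_1 assms that by (auto simp: unit_int_def)
  then have "d 0 = - \<alpha>"
    using real_analytic_on_const_extend[OF real_analytic_on_deriv_I[OF analytic] assms, of "- \<alpha>" 0]
    by (simp add: unit_int_def)
  then show False using critical(1) alpha_gt_1 by simp
qed

section \<open>The iterated preimages of \<open>J g\<close>\<close>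

lemma J_eq: "J g = {- (1 / \<alpha>)..1}" "J0 g = {- (1 / \<alpha>)..1 / \<alpha> / \<alpha>}" "J1 g = {c..1}"
  unfolding J_def J0_def J1_def iterates g_c by (simp_all only: g_1)

text \<open>The number \<open>- g 1\<close> separates the end points \<open>g c\<close> and
  \<open>c\<close>.\<close>

lemma J0_less_J1: "x \<in> J0 g \<Longrightarrow> y \<in> J1 g \<Longrightarrow> x < y"
  unfolding J_eq atLeastAtMost_iff using orbit g_c by linarith

lemma inj_on_g_J1: "inj_on g {c..1}"
proof -
  have "strict_antimono_on {0..1} g"
    using feigenbaum unfolding feigenbaum_map_def folding_map_def by blast
  then have "strict_antimono_on {c..1} g"
    using c_pos by (rule_tac monotone_on_subset) auto
  then show ?thesis by (force simp: monotone_on_def intro: linorder_inj_onI')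
qed

text \<open>The linear branch is inverted explicitly; the other one takes the end values of
  \<open>J g\<close> at \<open>c\<close> and 1, so the intermediate value theorem applies.
  Surjectivity lets the number of intervals double.\<close>

lemma sigma_branches_image:
  "J g \<subseteq> (\<lambda>x. - \<alpha> * x) ` J0 g" "J g \<subseteq> (\<lambda>x. - \<alpha> * g x) ` J1 g"
proof -
  show "J g \<subseteq> (\<lambda>x. - \<alpha> * x) ` J0 g"
  proof
    fix y assume "y \<in> J g"
    then have "- y / \<alpha> \<in> J0 g" "y = - \<alpha> * (- y / \<alpha>)"
      unfolding J_eq using alpha_gt_1 by (auto simp: field_simps)
    then show "y \<in> (\<lambda>x. - \<alpha> * x) ` J0 g" by blast
  qed
  show "J g \<subseteq> (\<lambda>x. - \<alpha> * g x) ` J1 g"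
  proof
    fix y assume y: "y \<in> J g"
    have "\<exists>x\<ge>c. x \<le> 1 \<and> - \<alpha> * g x = y"
    proof (rule IVT')
      show "- \<alpha> * g c \<le> y" "y \<le> - \<alpha> * g 1" "c \<le> 1"
        using y c_le_1 unfolding J_eq(1) atLeastAtMost_iff sigma_c sigma_1 by blast+
      show "continuous_on {c..1} (\<lambda>x. - \<alpha> * g x)"
        using c_pos by (intro continuous_intros continuous_on_subset[OF continuous_g]) (auto simp: unit_int_def)
    qed
    then show "y \<in> (\<lambda>x. - \<alpha> * g x) ` J1 g" unfolding J_eq by auto
  qed
qed

lemma sigma_preimage_eq:
  "sigma_preimage g S = {x \<in> J0 g. - \<alpha> * x \<in> S} \<union> {x \<in> J1 g. - \<alpha> * g x \<in> S}"
proof -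
  have "x \<notin> J1 g" if "x \<in> J0 g" for x using J0_less_J1[OF that, of x] by auto
  then show ?thesis unfolding sigma_preimage_def sigma_def by auto
qed

definition S :: "nat \<Rightarrow> real set" where "S n = (sigma_preimage g ^^ n) (J g)"

lemma S_Suc: "S (Suc n) = {x \<in> J0 g. - \<alpha> * x \<in> S n} \<union> {x \<in> J1 g. - \<alpha> * g x \<in> S n}"
  unfolding S_def by (simp add: sigma_preimage_eq)

lemma S_subset: "S n \<subseteq> J g"
proof (cases n)
  case (Suc m)
  have "J0 g \<union> J1 g \<subseteq> J g"
    unfolding J_eq Un_subset_iff atLeastatMost_subset_iff using inv_alpha c_le_1 orbit g_c by linarith
  then show ?thesis unfolding Suc S_Suc by blast
qed (simp add: S_def)

text \<open>By \<open>sigma_1\<close>, 1 is a fixed point of the branch on \<open>J1 g\<close>. This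
  later identifies the last right end point.\<close>

lemma one_in_S: "1 \<in> S n"
proof (induction n)
  case 0
  then show ?case using orbit unfolding S_def J_def by simp
next
  case (Suc n)
  then show ?case using Suc c_le_1 unfolding S_Suc J_eq by (auto simp only: sigma_1 atLeastAtMost_iff)
qed

text \<open>Each branch contributes one preimage per member. The halves stay separate because
  \<open>beta\<close> concerns only the intervals in \<open>J1 g\<close>.\<close>

lemma S_Suc_families:
  assumes F: "interval_family F" "\<Union>F = S n"
  shows "\<exists>F0 F1. interval_family (F0 \<union> F1) \<and> card F0 = card F \<and> card (F0 \<union> F1) = 2 * card F \<and>
    \<Union>F0 \<subseteq> J0 g \<and> \<Union>F1 \<subseteq> J1 g \<and> \<Union>(F0 \<union> F1) = S (Suc n)"
proof -
  have "\<exists>F0. interval_family F0 \<and> card F0 = card F \<and> \<Union>F0 = {x \<in> J0 g. - \<alpha> * x \<in> \<Union>F}"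
    unfolding J_eq
  proof (rule interval_family_preimage[OF F(1)])
    show "inj_on ((*) (- \<alpha>)) {- (1 / \<alpha>)..1 / \<alpha> / \<alpha>}" using alpha_gt_1 by (auto intro: inj_onI)
    show "\<Union>F \<subseteq> (*) (- \<alpha>) ` {- (1 / \<alpha>)..1 / \<alpha> / \<alpha>}"
      using F(2) S_subset sigma_branches_image(1) unfolding J_eq(2) by blast
  qed (intro continuous_intros)
  then obtain F0 where F0: "interval_family F0" "card F0 = card F" "\<Union>F0 = {x \<in> J0 g. - \<alpha> * x \<in> \<Union>F}"
    by blast
  have "\<exists>F1. interval_family F1 \<and> card F1 = card F \<and> \<Union>F1 = {x \<in> J1 g. - \<alpha> * g x \<in> \<Union>F}"
    unfolding J_eq
  proof (rule interval_family_preimage[OF F(1)])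
    show "continuous_on {c..1} (\<lambda>x. - \<alpha> * g x)"
      using c_pos by (intro continuous_intros continuous_on_subset[OF continuous_g]) (auto simp: unit_int_def)
    show "inj_on (\<lambda>x. - \<alpha> * g x) {c..1}"
      using inj_on_g_J1 alpha_gt_1 by (simp add: inj_on_def)
    show "\<Union>F \<subseteq> (\<lambda>x. - \<alpha> * g x) ` {c..1}"
      using F(2) S_subset sigma_branches_image(2) unfolding J_eq(3) by blast
  qed
  then obtain F1 where F1: "interval_family F1" "card F1 = card F" "\<Union>F1 = {x \<in> J1 g. - \<alpha> * g x \<in> \<Union>F}"
    by blast
  have disj: "A \<inter> B = {}" if "A \<in> F0" "B \<in> F1" for A B
  proof -
    have "A \<subseteq> J0 g" "B \<subseteq> J1 g" using F0(3) F1(3) that by blast+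
    then show ?thesis using J0_less_J1 by force
  qed
  have "F0 \<inter> F1 = {}" using disj F0(1) unfolding interval_family_def by blast
  then have "card (F0 \<union> F1) = 2 * card F"
    using F0 F1 by (subst card_Un_disjoint) (auto simp: interval_family_def)
  moreover have "interval_family (F0 \<union> F1)"
  proof -
    have "disjoint (F0 \<union> F1)"
      unfolding disjoint_def
    proof (intro ballI impI)
      fix A B assume AB: "A \<in> F0 \<union> F1" "B \<in> F0 \<union> F1" "A \<noteq> B"
      have "A \<in> F0 \<Longrightarrow> B \<in> F0 \<Longrightarrow> A \<inter> B = {}" "A \<in> F1 \<Longrightarrow> B \<in> F1 \<Longrightarrow> A \<inter> B = {}"
        using F0(1) F1(1) AB(3) by (simp_all add: interval_family_def disjoint_def)
      then show "A \<inter> B = {}" using AB disj[of A B] disj[of B A] by (auto simp: Int_commute)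
    qed
    then show ?thesis using F0(1) F1(1) by (auto simp: interval_family_def)
  qed
  moreover have "\<Union>(F0 \<union> F1) = S (Suc n)"
    using F0(3) F1(3) F(2) unfolding S_Suc by simp
  moreover have "\<Union>F0 \<subseteq> J0 g" "\<Union>F1 \<subseteq> J1 g" using F0(3) F1(3) by auto
  ultimately show ?thesis using F0(2) by blast
qed

lemma S_family: "\<exists>F. interval_family F \<and> card F = 2 ^ n \<and> \<Union>F = S n"
proof (induction n)
  case 0
  have "interval_family {J g}"
    unfolding interval_family_def J_def using orbit by (auto simp: disjoint_def)
  then show ?case by (intro exI[of _ "{J g}"]) (auto simp: S_def)
next
  case (Suc n)
  then obtain F where F: "interval_family F" "card F = 2 ^ n" "\<Union>F = S n" by blast
  show ?case using S_Suc_families[OF F(1,3)] F(2) by (metis power_Suc)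
qed

section \<open>Right end points and slopes\<close>

text \<open>The upper half of the sorted list consists of members of \<open>F1\<close>, which lie in
  \<open>J1 g\<close>. Each contains its supremum by compactness, so the order of the members passes
  to the end points.\<close>

lemma b_right_facts:
  assumes n: "1 \<le> n"
  shows "\<And>i. i \<in> {1..2 ^ (n - 1)} \<Longrightarrow> b_right g n i \<in> {c..1}"
    and "strict_mono_on {1..2 ^ (n - 1)} (b_right g n)"
    and "b_right g n (2 ^ (n - 1)) = 1"
proof -
  define M where "M = (2::nat) ^ (n - 1)"
  obtain m where m: "n = Suc m" using n by (cases n) auto
  obtain F where F: "interval_family F" "card F = M" "\<Union>F = S m"
    using S_family[of m] unfolding M_def m by auto
  obtain F0 F1 where F01: "interval_family (F0 \<union> F1)" "card F0 = M" "card (F0 \<union> F1) = 2 * M"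
    "\<Union>F0 \<subseteq> J0 g" "\<Union>F1 \<subseteq> J1 g" "\<Union>(F0 \<union> F1) = S n"
    using S_Suc_families[OF F(1,3)] unfolding F(2) m by blast
  define L where "L = sorted_key_list_of_set Inf (F0 \<union> F1)"
  note L = interval_family_sorted[OF F01(1), folded L_def]
  have "components (S n) = F0 \<union> F1"
    using components_Union_interval_family[OF F01(1)] F01(6) by simp
  \<comment> \<open>Labels count from 1 and list positions from 0, hence the position
    \<open>M + i - 1\<close>.\<close>
  then have b: "b_right g n i = Sup (L ! (M + i - 1))" for i
    unfolding b_right_def J_interval_def L_def M_def S_def by simp
  have LF1: "L ! (M + i - 1) \<in> F1" if "i \<in> {1..M}" for i
    unfolding L_def
  proof (rule interval_family_upper_half[OF F01(1-3)])
    fix x y assume "x \<in> \<Union>F0" "y \<in> \<Union>F1"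
    then show "x < y" using F01(4,5) by (intro J0_less_J1) blast+
  qed (use that in auto)
  have LK: "L ! (M + i - 1) \<noteq> {}" "compact (L ! (M + i - 1))" if "i \<in> {1..M}" for i
    using LF1[OF that] F01(1) unfolding interval_family_def by blast+
  have b_in: "b_right g n i \<in> L ! (M + i - 1)" if "i \<in> {1..M}" for i
    unfolding b using LK[OF that]
    by (intro closed_contains_Sup compact_imp_closed bounded_imp_bdd_above compact_imp_bounded)
  show J1: "b_right g n i \<in> {c..1}" if "i \<in> {1..2 ^ (n - 1)}" for i
    using b_in[of i] LF1[of i] that F01(5) unfolding M_def[symmetric] J_eq by blast
  show mono: "strict_mono_on {1..2 ^ (n - 1)} (b_right g n)"
    unfolding M_def[symmetric]
  proof (rule strict_mono_onI)
    fix i j assume "i \<in> {1..M}" "j \<in> {1..M}" "i < j"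
    then show "b_right g n i < b_right g n j"
      using L(3)[OF _ _ b_in[of i] b_in[of j]] F01(3) by auto
  qed
  show "b_right g n (2 ^ (n - 1)) = 1"
  proof -
    have M: "0 < M" unfolding M_def by simp
    have "1 \<in> \<Union>(set L)" using one_in_S[of n] F01(6) L(1) by simp
    then obtain k where k: "k < 2 * M" "1 \<in> L ! k" using L(2) F01(3) by (auto simp: in_set_conv_nth)
    have "1 \<le> b_right g n M"
    \<comment> \<open>If 1 lay in an earlier interval, the last right end point would exceed 1, so
      the lower bound holds in both cases; \<open>J1\<close> supplies the upper bound.\<close>
    proof (cases "k = 2 * M - 1")
      case True
      then have "1 \<in> L ! (M + M - 1)" using k by (simp add: mult_2)
      moreover have "bdd_above (L ! (M + M - 1))"
        using LK(2)[of M] M by (intro bounded_imp_bdd_above compact_imp_bounded) auto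
      ultimately show ?thesis unfolding b by (rule cSup_upper)
    next
      case False
      then have "1 < b_right g n M"
        using L(3)[OF _ _ k(2) b_in[of M]] k(1) F01(3) M by auto
      then show ?thesis by simp
    qed
    then show ?thesis using J1[of M] M unfolding M_def by auto
  qed
qed

text \<open>On \<open>{c..1}\<close> the slope is \<open>- d\<close>, which is nondecreasing because
  \<open>g\<close> is concave; the bounds come from \<open>d_c\<close>,
  \<open>d_gt_minus_alpha\<close> and \<open>d_1\<close>.\<close>

lemma beta_facts:
  assumes n: "2 \<le> n"
  shows "mono_on {1..2 ^ (n - 1)} (beta g n)" "1 \<le> beta g n 1" "beta g n 1 < \<alpha>"
    and "beta g n (2 ^ (n - 1)) = \<alpha>"
proof -
  define M where "M = (2::nat) ^ (n - 1)"
  have M: "1 < M" unfolding M_def using n by (intro one_less_power) auto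
  have "1 \<le> n" using n by simp
  note b = b_right_facts[OF this, folded M_def]
  have beta: "beta g n i = - d (b_right g n i)" if "i \<in> {1..M}" for i
    using d_nonpos[of "b_right g n i"] b(1)[OF that] c_pos unfolding beta_def by auto
  have I: "b_right g n i \<in> unit_int" "c \<le> b_right g n i" if "i \<in> {1..M}" for i
    using b(1)[OF that] c_pos by (auto simp: unit_int_def)
  show "mono_on {1..2 ^ (n - 1)} (beta g n)"
    unfolding M_def[symmetric]
  proof (rule mono_onI)
    fix i j assume ij: "i \<in> {1..M}" "j \<in> {1..M}" "i \<le> j"
    then have "b_right g n i \<le> b_right g n j"
      using strict_mono_on_leD[OF b(2)] by blast
    then show "beta g n i \<le> beta g n j" using d_antimono I ij by (simp add: beta)
  qed
  have 1: "1 \<in> {1..M}" "M \<in> {1..M}" using M by auto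
  have "d (b_right g n 1) \<le> d c" using I[OF 1(1)] c_pos c_le_1 by (intro d_antimono) (auto simp: unit_int_def)
  then show "1 \<le> beta g n 1" using d_c unfolding beta[OF 1(1)] by linarith
  \<comment> \<open>Here \<open>n \<ge> 2\<close> matters: as \<open>M > 1\<close>, the first right
    end point is not the last one.\<close>
  have "b_right g n 1 < 1" using strict_mono_onD[OF b(2) 1 M] b(3) by simp
  then show "beta g n 1 < \<alpha>"
    using d_gt_minus_alpha[of "b_right g n 1"] I(1)[OF 1(1)] unfolding beta[OF 1(1)] by (simp add: unit_int_def)
  show "beta g n (2 ^ (n - 1)) = \<alpha>"
    unfolding M_def[symmetric] using b(3) d_1 unfolding beta[OF 1(2)] by simp
qed

end

section \<open>The matrix \<open>A\<^sub>n\<close>\<close>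

text \<open>Translates the ceiling in \<open>A_entry\<close> to the 0-based row index
  \<open>i\<close>.\<close>

lemma ceiling_half: "nat \<lceil>real (Suc i) / 2\<rceil> = Suc (i div 2)"
proof -
  have "\<lceil>real (Suc i) / 2\<rceil> = int (Suc (i div 2))"
  proof (rule ceiling_unique)
    have "real i = 2 * real (i div 2) + real (i mod 2)"
      by (metis mult_div_mod_eq of_nat_add of_nat_mult of_nat_numeral)
    moreover have "i mod 2 = 0 \<or> i mod 2 = 1" by auto
    ultimately show "real_of_int (int (Suc (i div 2))) - 1 < real (Suc i) / 2"
      "real (Suc i) / 2 \<le> real_of_int (int (Suc (i div 2)))" by auto
  qed
  then show ?thesis by simp
qed

text \<open>In 0-based indices the two columns of row \<open>i\<close> lie symmetrically about the
  middle and move outwards as \<open>i\<close> grows.\<close>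

lemma A_matrix_mult:
  assumes n: "2 \<le> n" and i: "i < 2 ^ (n - 1)"
  defines "H \<equiv> 2 ^ (n - 2)"
  shows "(\<Sum>j<2 ^ (n - 1). A_matrix g n $$ (i, j) * v j) =
    alpha g * (beta g n (i + 1) * v (H + i div 2) - v (H - Suc (i div 2)))"
proof -
  have "n - 1 = Suc (n - 2)" using n by simp
  then have N: "2 ^ (n - 1) = 2 * H" unfolding H_def by (simp only: power_Suc)
  have k: "i div 2 < H" using i N by auto
  have entry: "A_matrix g n $$ (i, j) * v j = (if j = H - Suc (i div 2) then - alpha g * v j else 0)
      + (if j = H + i div 2 then alpha g * beta g n (i + 1) * v j else 0)" if "j < 2 ^ (n - 1)" for j
  proof -
    have "A_matrix g n $$ (i, j) = (if j + 1 = H + 1 - Suc (i div 2) then - alpha g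
        else if j + 1 = H + Suc (i div 2) then alpha g * beta g n (i + 1) else 0)"
      unfolding A_matrix_def using i that ceiling_half[of i]
      by (simp add: A_entry_def H_def)
    \<comment> \<open>No subtraction truncates, since \<open>i div 2 < H\<close>.\<close>
    moreover have "j + 1 = H + 1 - Suc (i div 2) \<longleftrightarrow> j = H - Suc (i div 2)"
      "j + 1 = H + Suc (i div 2) \<longleftrightarrow> j = H + i div 2" "H - Suc (i div 2) \<noteq> H + i div 2"
      using k by auto
    ultimately show ?thesis by simp
  qed
  have "H - Suc (i div 2) < 2 ^ (n - 1)" "H + i div 2 < 2 ^ (n - 1)" using k N by auto
  moreover have "(\<Sum>j<2 ^ (n - 1). A_matrix g n $$ (i, j) * v j) =
      (\<Sum>j<2 ^ (n - 1). (if j = H - Suc (i div 2) then - alpha g * v j else 0)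
        + (if j = H + i div 2 then alpha g * beta g n (i + 1) * v j else 0))"
    using entry by (intro sum.cong) auto
  ultimately show ?thesis by (simp add: sum.distrib algebra_simps)
qed

theorem propositionD:
  fixes g :: "real \<Rightarrow> real" and n :: nat
  assumes "feigenbaum_map g"
    and "concave_on {-1..1} g"
    and "n \<ge> 2"
  shows "\<exists>lam::real. eigenvalue (A_matrix g n) lam \<and> lam > alpha g * (alpha g - 1)"
proof -
  interpret concave_feigenbaum g by unfold_locales fact+
  define H where "H = (2::nat) ^ (n - 2)"
  define N where "N = (2::nat) ^ (n - 1)"
  define \<beta> where "\<beta> = (\<lambda>i. beta g n (i + 1))"
  have "n - 1 = Suc (n - 2)" using assms(3) by simp
  then have N: "N = 2 * H" "0 < H" unfolding N_def H_def by (simp_all only: power_Suc) simp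
  note mult = A_matrix_mult[OF assms(3), of _ g, folded N_def H_def \<beta>_def]
  note facts = beta_facts[OF assms(3), folded N_def]
  have \<beta>_mono: "\<beta> i \<le> \<beta> j" if "i \<le> j" "j < N" for i j
    unfolding \<beta>_def using that by (intro mono_onD[OF facts(1)]) auto
  have \<beta>_0: "1 \<le> \<beta> 0" "\<beta> 0 < \<alpha>" and \<beta>_last: "\<beta> (N - 1) = \<alpha>"
    unfolding \<beta>_def using facts(2-4) N by simp_all
  have "\<exists>t\<ge>\<alpha>\<^sup>2 - \<beta> 0. eigenvalue (A_matrix g n) t"
  proof (rule monotone_cone_eigenvalue_ge[where N = N and p = "\<alpha> + 1" and q = 1])
    fix v :: "nat \<Rightarrow> real"
    assume v: "mono_on {..<N} v" "0 \<le> v 0"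
    define w where "w = (\<lambda>i. \<Sum>j<N. A_matrix g n $$ (i, j) * v j)"
    have w: "w i = \<alpha> * (\<beta> i * v (H + i div 2) - v (H - Suc (i div 2)))" if "i < N" for i
      unfolding w_def using mult[OF that] by (simp add: \<beta>_def)
    have v_mono: "v i \<le> v j" if "i \<le> j" "j < N" for i j
      using that by (intro mono_onD[OF v(1)]) auto
    have v_nonneg: "0 \<le> v i" if "i < N" for i
      using v_mono[of 0 i] v(2) that by simp
    \<comment> \<open>Down the rows the positive column moves right with nondecreasing coefficient,
      while the negative one moves left.\<close>
    have "w i \<le> w j" if ij: "i \<le> j" "j < N" for i j
    proof -
      have div: "i div 2 \<le> j div 2" "j div 2 < H" using ij N by (auto intro: div_le_mono)
      have "\<beta> i * v (H + i div 2) \<le> \<beta> j * v (H + j div 2)"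
        using \<beta>_mono[OF ij] \<beta>_mono[of 0 i] \<beta>_0 ij div N
        by (intro mult_mono v_mono v_nonneg) auto
      moreover have "v (H - Suc (j div 2)) \<le> v (H - Suc (i div 2))"
        using div N by (intro v_mono) auto
      ultimately show ?thesis using w ij alpha_gt_1 by (simp add: mult_left_mono)
    qed
    \<comment> \<open>Row 0 uses the neighbouring columns \<open>H - 1\<close> and \<open>H\<close>,
      and \<open>\<beta> 0 \<ge> 1\<close>.\<close>
    moreover have "0 \<le> w 0"
    proof -
      have "v (H - 1) \<le> 1 * v H" using v_mono[of "H - 1" H] N by simp
      also have "\<dots> \<le> \<beta> 0 * v H" using \<beta>_0 N by (intro mult_right_mono v_nonneg) auto
      finally show ?thesis using w[of 0] N alpha_gt_1 by simp
    qed
    ultimately have "mono_on {..<N} w \<and> 0 \<le> w 0" by (auto intro: mono_onI)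
    then show "mono_on {..<N} (\<lambda>i. \<Sum>j<N. A_matrix g n $$ (i, j) * v j) \<and>
        0 \<le> (\<Sum>j<N. A_matrix g n $$ (0, j) * v j)"
      unfolding w_def .
    have idx: "H + (N - 1) div 2 = N - 1" "H - Suc ((N - 1) div 2) = 0" using N by auto
    have "w (N - 1) = \<alpha> * (\<alpha> * v (N - 1) - v 0)"
      using w[of "N - 1"] N \<beta>_last unfolding idx by simp
    \<comment> \<open>The last row already uses the outermost columns. Moving row 0 there can only
      increase its value, so both rows involve just \<open>v (N - 1)\<close> and
      \<open>v 0\<close>.\<close>
    moreover have "w 0 \<le> \<alpha> * (\<beta> 0 * v (N - 1) - v 0)"
    proof -
      have "v H \<le> v (N - 1)" "v 0 \<le> v (H - 1)" using N by (auto intro: v_mono)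
      then have "\<beta> 0 * v H - v (H - 1) \<le> \<beta> 0 * v (N - 1) - v 0"
        using \<beta>_0 by (intro diff_mono mult_left_mono) auto
      then show ?thesis using w[of 0] N alpha_gt_1 by (simp add: mult_left_mono)
    qed
    \<comment> \<open>The choice \<open>p = \<alpha> + 1\<close> gives \<open>v (N - 1)\<close> and
      \<open>v 0\<close> opposite coefficients in the remainder, which is then nonnegative for
      nondecreasing \<open>v\<close>.\<close>
    moreover have "(\<alpha> + 1) * (\<alpha> * (\<alpha> * v (N - 1) - v 0)) - \<alpha> * (\<beta> 0 * v (N - 1) - v 0)
        - (\<alpha>\<^sup>2 - \<beta> 0) * ((\<alpha> + 1) * v (N - 1) - v 0) = \<beta> 0 * (v (N - 1) - v 0)"
      by (simp add: algebra_simps power2_eq_square)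
    moreover have "0 \<le> \<beta> 0 * (v (N - 1) - v 0)"
      using \<beta>_0 v_mono[of 0 "N - 1"] N by simp
    ultimately have "(\<alpha>\<^sup>2 - \<beta> 0) * ((\<alpha> + 1) * v (N - 1) - 1 * v 0) \<le> (\<alpha> + 1) * w (N - 1) - 1 * w 0"
      by simp
    then show "(\<alpha>\<^sup>2 - \<beta> 0) * ((\<alpha> + 1) * v (N - 1) - 1 * v 0) \<le>
        (\<alpha> + 1) * (\<Sum>j<N. A_matrix g n $$ (N - 1, j) * v j) - 1 * (\<Sum>j<N. A_matrix g n $$ (0, j) * v j)"
      unfolding w_def .
  qed (use alpha_gt_1 N in \<open>auto simp: A_matrix_def N_def\<close>)
  moreover have "\<alpha> * (\<alpha> - 1) < \<alpha>\<^sup>2 - \<beta> 0"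
    using \<beta>_0(2) by (simp add: algebra_simps power2_eq_square)
  ultimately show ?thesis by (meson less_le_trans)
qed

end
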